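(* Let $X,Y$ be Fréchet spaces and let $((T_{j,k})_{k\in\mathbb N})_{1\le j\le N}$ be a tuple of sequences of operators in $L(X,Y)$. Suppose that the following two conditions hold: (1) there exists a dense linear subspace $X_0$ of $X$ such that for each $x\in X_0$ there exists a set $A_x\subseteq\mathbb N$ with $\overline{dens}(A_x)=1$ and $\lim_{k\in A_x,\,k\to\infty}T_{j,k}x=0$ for all $1\le j\le N$; (2) there exist a sequence $(y_l)_{l\in\mathbb N}$ in $X$ converging to zero, a number $\epsilon>0$, a strictly increasing sequence $(N_l)$ in $\mathbb N$ and an integer $m\in\mathbb N$ such that, for every $l\in\mathbb N$, $$card\bigl(\{1\le k\le N_l:\ p_m^Y(T_{j,k}y_l)>\epsilon\ \text{for all }1\le j\le N\}\bigr)\ge N_l(1-l^{-1})$$ (in the case that $Y$ is a Banach space, $p_m^Y(T_{j,k}y_l)$ is replaced by $\|T_{j,k}y_l\|_Y$). Then there exists a $(d,1)$-distributionally irregular vector for $((T_{j,k})_{k\in\mathbb N})_{1\le j\le N}$, and in particular $((T_{j,k})_{k\in\mathbb N})_{1\le j\le N}$ is $(d,1)$-distributionally chaotic.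
   Context: $X,Y$ are non-trivial Fréchet spaces over the same field $\mathbb K\in\{\mathbb R,\mathbb C\}$; the topology of $Y$ is induced by an increasing fundamental system of seminorms $(p_n^Y)_{n\in\mathbb N}$ and $d_Y(x,y)=\sum_{n\ge1}2^{-n}\frac{p_n^Y(x-y)}{1+p_n^Y(x-y)}$; if $Y$ is a Banach space, $d_Y(x,y)=\|x-y\|_Y$ instead. $L(X,Y)$ is the space of continuous linear operators from $X$ to $Y$. $N\ge2$. For $D\subseteq\mathbb N$, $\overline{dens}(D)=\limsup_{n\to\infty}\frac{card(D\cap[1,n])}{n}$. A vector $x\in X$, $x\ne0$, is $(d,1)$-distributionally irregular for $((T_{j,k})_k)_j$ iff there exists $A\subseteq\mathbb N$ with $\overline{dens}(A)=1$ and $\lim_{k\in A,k\to\infty}T_{j,k}x=0$ for all $1\le j\le N$, and there exist $m\in\mathbb N$ and $B\subseteq\mathbb N$ with $\overline{dens}(B)=1$ and $\lim_{k\in B,k\to\infty}p_m^Y(T_{j,k}x)=\infty$ for all $1\le j\le N$ (with $\|\cdot\|_Y$ in place of $p_m^Y$ if $Y$ is a Banach space). $((T_{j,k})_k)_j$ is $(d,1)$-distributionally chaotic iff there exist an uncountable set $S\subseteq X$ and $\sigma>0$ such that for each $\epsilon>0$ and each pair $x,y\in S$ of distinct points, $\overline{dens}\big(\bigcap_{1\le j\le N}\{k:d_Y(T_{j,k}x,T_{j,k}y)\ge\sigma\}\big)=1$ and $\overline{dens}\big(\bigcap_{1\le j\le N}\{k:d_Y(T_{j,k}x,T_{j,k}y)<\epsilon\}\big)=1$.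 *)

theory Defs
  imports "HOL-Analysis.Analysis"
begin

(* The scalar field is a type 'k of class real_normed_field. Such a field carries a
   multiplicative norm extending the absolute value of the reals, so by the theorem of
   Gelfand and Mazur it is a copy of the real or of the complex numbers. *)

definition seminorm :: "('k::real_normed_field \<Rightarrow> 'a::ab_group_add \<Rightarrow> 'a) \<Rightarrow> ('a \<Rightarrow> real) \<Rightarrow> bool" where
  "seminorm scl q \<longleftrightarrow>
     (\<forall>x y. q (x + y) \<le> q x + q y) \<and> (\<forall>c x. q (scl c x) = norm c * q x)"

(* The family need not be strictly increasing. The index set is {0, 1, 2, ...}:
   p n is the (n+1)-st seminorm of a family indexed by the positive integers. *)
definition fundamental_seminorms ::
  "('k::real_normed_field \<Rightarrow> 'a::{ab_group_add,topological_space} \<Rightarrow> 'a) \<Rightarrow> (nat \<Rightarrow> 'a \<Rightarrow> real) \<Rightarrow> bool" where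
  "fundamental_seminorms scl p \<longleftrightarrow>
     (\<forall>n. seminorm scl (p n)) \<and>
     (\<forall>n x. p n x \<le> p (Suc n) x) \<and>
     (\<forall>U. open U \<longleftrightarrow> (\<forall>x\<in>U. \<exists>n. \<exists>e>0. {y. p n (y - x) < e} \<subseteq> U))"

definition topology_norm ::
  "('k::real_normed_field \<Rightarrow> 'a::{ab_group_add,topological_space} \<Rightarrow> 'a) \<Rightarrow> ('a \<Rightarrow> real) \<Rightarrow> bool" where
  "topology_norm scl q \<longleftrightarrow>
     seminorm scl q \<and>
     (\<forall>x. q x = 0 \<longrightarrow> x = 0) \<and>
     (\<forall>U. open U \<longleftrightarrow> (\<forall>x\<in>U. \<exists>e>0. {y. q (y - x) < e} \<subseteq> U))"

locale frechet_space = vector_space scl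
  for scl :: "'k::real_normed_field \<Rightarrow> 'a::{ab_group_add,t2_space} \<Rightarrow> 'a" +
  assumes ex_fundamental_seminorms: "\<exists>p. fundamental_seminorms scl p"
    and complete: "\<And>u :: nat \<Rightarrow> 'a.
      (\<forall>U. open U \<and> 0 \<in> U \<longrightarrow> (\<exists>M. \<forall>i\<ge>M. \<forall>j\<ge>M. u i - u j \<in> U)) \<Longrightarrow> convergent u"

definition continuous_linear_operators ::
  "('k::real_normed_field \<Rightarrow> 'a::{ab_group_add,topological_space} \<Rightarrow> 'a) \<Rightarrow>
   ('k \<Rightarrow> 'b::{ab_group_add,topological_space} \<Rightarrow> 'b) \<Rightarrow> ('a \<Rightarrow> 'b) set" where
  "continuous_linear_operators scaleX scaleY =
     {T. Vector_Spaces.linear scaleX scaleY T \<and> continuous_on UNIV T}"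

(* The data that fix the metric of the target space: a fundamental system of seminorms,
   or, for a Banach space, its norm. In the second case the norm replaces every seminorm
   and the metric is the one induced by the norm. *)
datatype 'b metric_data = Seminorms "nat \<Rightarrow> 'b \<Rightarrow> real" | Norm "'b \<Rightarrow> real"

fun induces_topology ::
  "('k::real_normed_field \<Rightarrow> 'b::{ab_group_add,topological_space} \<Rightarrow> 'b) \<Rightarrow> 'b metric_data \<Rightarrow> bool" where
  "induces_topology scl (Seminorms p) = fundamental_seminorms scl p"
| "induces_topology scl (Norm q) = topology_norm scl q"

fun seminorm_of :: "'b metric_data \<Rightarrow> nat \<Rightarrow> 'b \<Rightarrow> real" where
  "seminorm_of (Seminorms p) m x = p m x"
| "seminorm_of (Norm q) m x = q x"

fun dist_of :: "'b::ab_group_add metric_data \<Rightarrow> 'b \<Rightarrow> 'b \<Rightarrow> real" where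
  "dist_of (Seminorms p) x y = (\<Sum>n. (1/2) ^ Suc n * (p n (x - y) / (1 + p n (x - y))))"
| "dist_of (Norm q) x y = q (x - y)"

(* Sets of positive integers are represented by sets of type nat set; whether 0 is
   a member affects neither the density nor a limit along the set. *)
definition upper_density :: "nat set \<Rightarrow> ereal" where
  "upper_density D = limsup (\<lambda>n. ereal (real (card (D \<inter> {1..n})) / real n))"

definition seq_within :: "nat set \<Rightarrow> nat filter" where
  "seq_within A = inf sequentially (principal A)"

definition distributionally_irregular ::
  "'b::{ab_group_add,topological_space} metric_data \<Rightarrow> nat \<Rightarrow> (nat \<Rightarrow> nat \<Rightarrow> 'a::ab_group_add \<Rightarrow> 'b) \<Rightarrow> 'a \<Rightarrow> bool" where
  "distributionally_irregular G N T x \<longleftrightarrow>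
     x \<noteq> 0 \<and>
     (\<exists>A. upper_density A = 1 \<and>
        (\<forall>j\<in>{1..N}. ((\<lambda>k. T j k x) \<longlongrightarrow> 0) (seq_within A))) \<and>
     (\<exists>m B. upper_density B = 1 \<and>
        (\<forall>j\<in>{1..N}. filterlim (\<lambda>k. seminorm_of G m (T j k x)) at_top (seq_within B)))"

definition distributionally_chaotic ::
  "'b::ab_group_add metric_data \<Rightarrow> nat \<Rightarrow> (nat \<Rightarrow> nat \<Rightarrow> 'a \<Rightarrow> 'b) \<Rightarrow> bool" where
  "distributionally_chaotic G N T \<longleftrightarrow>
     (\<exists>S \<sigma>. uncountable S \<and> \<sigma> > 0 \<and>
        (\<forall>\<epsilon>>0. \<forall>x\<in>S. \<forall>y\<in>S. x \<noteq> y \<longrightarrow>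
           upper_density (\<Inter>j\<in>{1..N}. {k. dist_of G (T j k x) (T j k y) \<ge> \<sigma>}) = 1 \<and>
           upper_density (\<Inter>j\<in>{1..N}. {k. dist_of G (T j k x) (T j k y) < \<epsilon>}) = 1))"

end

theory Submission
  imports Defs
begin

text \<open>
  The theorem is a Baire category argument on \<open>X\<close>.  Write \<open>q n\<close> for the seminorms of \<open>Y\<close>.
  A vector \<open>x\<close> is irregular as soon as, for every \<open>n\<close>, each of the two sets
  \<open>{k. \<forall>j. q n (T j k x) < 1 / (n + 1)}\<close> and \<open>{k. \<forall>j. q m (T j k x) > n}\<close> has upper
  density one: both families decrease with \<open>n\<close>, and a decreasing sequence of sets of upper
  density one has a pseudo-intersection of upper density one
  (\<open>upper_density_pseudo_intersection\<close>), along which \<open>T j k x\<close> tends to zero, respectively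
  \<open>q m (T j k x)\<close> tends to infinity.

  That a set of the form \<open>{k. x \<in> V k}\<close>, with \<open>V k\<close> open, has upper density one means that \<open>x\<close>
  belongs to countably many open sets, each asking only for one finite stretch \<open>{1..M}\<close> most of
  whose elements \<open>k\<close> satisfy \<open>x \<in> V k\<close>.  By Baire's theorem one vector does this for countably
  many sequences \<open>V\<close> at once, provided that these open sets are dense
  (\<open>ex_upper_density_1\<close>).  For the first family they contain the dense set \<open>X\<^sub>0\<close>.

  For the second family (\<open>ex_seminorms_large\<close>) an arbitrary vector \<open>x\<^sub>0\<close> is perturbed by small
  multiples of \<open>y l\<close>.  A single multiple might cancel against \<open>T j k x\<^sub>0\<close> for many \<open>k\<close>, but if
  \<open>q m (T j k (y l)) > \<epsilon>\<close> and the multiples are far enough apart, then for each such pair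
  \<open>j\<close>, \<open>k\<close> at most one of the vectors \<open>x\<^sub>0 + i a y l\<close>, \<open>i < K\<close>, can have \<open>q m (T j k _) \<le> n\<close>.  Averaging over
  \<open>i\<close> gives an \<open>i\<close> for which this fails only for a proportion of about \<open>N / K + 1 / l\<close> of the
  \<open>k \<le> M l\<close>; first \<open>K\<close> and then \<open>l\<close> are taken large.

  Finally the real line through an irregular vector is an uncountable distributionally scrambled
  set, because differences of its points are nonzero multiples of that vector.
\<close>

section \<open>Upper density one\<close>

lemma upper_density_le_1: "upper_density D \<le> 1"
proof -
  have "card (D \<inter> {1..n}) \<le> n" for n
    using card_mono[of "{1..n}" "D \<inter> {1..n}"] by simp
  then have "real (card (D \<inter> {1..n})) / real n \<le> 1" for n
    by (simp add: divide_le_eq del: One_nat_def)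
  then show ?thesis
    unfolding upper_density_def by (intro Limsup_bounded) (simp add: one_ereal_def)
qed

text \<open>
  Only the existence of long, almost full initial stretches matters.  In this form the condition is
  a countable intersection of conditions on finitely many indices, which is what makes it
  accessible to a category argument.
\<close>

lemma upper_density_eq_1_iff:
  "upper_density D = 1 \<longleftrightarrow>
     (\<forall>e>0. \<forall>n. \<exists>M>n. (1 - e) * real M < real (card (D \<inter> {1..M})))" (is "?L \<longleftrightarrow> ?R")
proof
  assume L: ?L
  show ?R
  proof (intro allI impI, rule ccontr)
    fix e :: real and n :: nat
    assume e: "e > 0" and neg: "\<not> (\<exists>M>n. (1 - e) * real M < real (card (D \<inter> {1..M})))"
    have "real (card (D \<inter> {1..M})) / real M \<le> 1 - e" if "M > n" for M
    proof -
      from that e have "real (card (D \<inter> {1..M})) \<le> (1 - e) * real M"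
        using neg by (meson not_less)
      with that show ?thesis by (simp add: divide_le_eq del: One_nat_def)
    qed
    then have "\<forall>\<^sub>F M in sequentially. ereal (real (card (D \<inter> {1..M})) / real M) \<le> ereal (1 - e)"
      by (intro eventually_sequentiallyI[of "Suc n"]) auto
    then have "upper_density D \<le> ereal (1 - e)"
      unfolding upper_density_def by (rule Limsup_bounded)
    with L e show False by (simp add: one_ereal_def)
  qed
next
  assume R: ?R
  have "\<not> upper_density D < 1"
  proof
    assume "upper_density D < 1"
    then obtain c where c: "upper_density D < ereal c" "c < 1"
      using ereal_dense2[of "upper_density D" 1] by (auto simp: one_ereal_def)
    then have "\<forall>\<^sub>F M in sequentially. ereal (real (card (D \<inter> {1..M})) / real M) < ereal c"
      unfolding upper_density_def by (intro Limsup_lessD)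
    then obtain n where n: "\<And>M. M \<ge> n \<Longrightarrow> real (card (D \<inter> {1..M})) / real M < c"
      by (auto simp: eventually_sequentially)
    obtain M where "M > n" "(1 - (1 - c)) * real M < real (card (D \<inter> {1..M}))"
      using R[rule_format, of "1 - c" n] c by auto
    with n[of M] show False by (simp add: divide_less_eq)
  qed
  with upper_density_le_1[of D] show ?L by (simp add: not_less)
qed

lemma eventually_seq_within:
  "eventually P (seq_within A) \<longleftrightarrow> (\<exists>K. \<forall>k\<in>A. K \<le> k \<longrightarrow> P k)"
  by (auto simp: seq_within_def eventually_inf_principal eventually_sequentially)

lemma upper_density_eventually:
  assumes A: "upper_density A = 1" and "eventually P (seq_within A)"
  shows "upper_density {k. P k} = 1"
  unfolding upper_density_eq_1_iff
proof (intro allI impI)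
  fix e :: real and n :: nat
  assume e: "e > 0"
  obtain K where K: "\<And>k. k \<in> A \<Longrightarrow> K \<le> k \<Longrightarrow> P k"
    using assms(2) by (auto simp: eventually_seq_within)
  \<comment> \<open>The indices below \<open>K\<close>, where \<open>P\<close> may fail, cost at most half of the tolerance.\<close>
  obtain M where M: "M > max n (nat \<lceil>real K / (e/2)\<rceil>)"
      "(1 - e/2) * real M < real (card (A \<inter> {1..M}))"
    using A e unfolding upper_density_eq_1_iff by (meson half_gt_zero)
  have "A \<inter> {1..M} \<subseteq> ({k. P k} \<inter> {1..M}) \<union> {..<K}"
    using K by force
  then have "card (A \<inter> {1..M}) \<le> card (({k. P k} \<inter> {1..M}) \<union> {..<K})"
    by (intro card_mono) auto
  also have "\<dots> \<le> card ({k. P k} \<inter> {1..M}) + K"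
    using card_Un_le[of "{k. P k} \<inter> {1..M}" "{..<K}"] by simp
  finally have 1: "real (card (A \<inter> {1..M})) \<le> real (card ({k. P k} \<inter> {1..M})) + real K"
    by linarith
  have "real K / (e/2) \<le> real M" using M(1) by linarith
  then have "real K \<le> e/2 * real M" using e by (simp add: field_simps)
  with 1 M have "(1 - e) * real M < real (card ({k. P k} \<inter> {1..M}))"
    by (simp add: algebra_simps)
  with M(1) show "\<exists>M>n. (1 - e) * real M < real (card ({k. P k} \<inter> {1..M}))" by auto
qed

text \<open>
  The set \<open>A\<close> follows \<open>D i\<close> on a block \<open>{g i<..g (Suc i)}\<close> that is so long that the part of
  \<open>{1..g (Suc i)}\<close> before the block is negligible.  Hence \<open>A\<close> is almost full at the end of each
  block, and as the \<open>D i\<close> decrease, \<open>A\<close> lies in \<open>D n\<close> from the \<open>n\<close>-th block on.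
\<close>

lemma upper_density_pseudo_intersection:
  fixes D :: "nat \<Rightarrow> nat set"
  assumes dec: "decseq D" and D: "\<And>n. upper_density (D n) = 1"
  obtains A where "upper_density A = 1" "\<And>n. \<forall>\<^sub>F k in seq_within A. k \<in> D n"
proof -
  define Q where "Q = (\<lambda>i a b. a < b \<and> (1 - 1 / real (Suc i)) * real b < real (card (D i \<inter> {a<..b})))"
  have "\<exists>b. Q i a b" for i a
  proof -
    define e where "e = 1 / real (Suc i) / 2"
    have e: "e > 0" by (simp add: e_def)
    obtain b where b: "b > max a (nat \<lceil>real a / e\<rceil>)" "(1 - e) * real b < real (card (D i \<inter> {1..b}))"
      using D[of i] e unfolding upper_density_eq_1_iff by meson
    have "card (D i \<inter> {1..b}) \<le> card ((D i \<inter> {a<..b}) \<union> {1..a})"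
      by (intro card_mono) auto
    also have "\<dots> \<le> card (D i \<inter> {a<..b}) + a"
      using card_Un_le[of "D i \<inter> {a<..b}" "{1..a}"] by simp
    finally have 1: "real (card (D i \<inter> {1..b})) \<le> real (card (D i \<inter> {a<..b})) + real a"
      by linarith
    have "real a / e \<le> real b" using b(1) by linarith
    then have "real a \<le> e * real b" using e by (simp add: field_simps)
    with 1 b have "(1 - 2 * e) * real b < real (card (D i \<inter> {a<..b}))"
      by (simp add: algebra_simps)
    with b(1) show ?thesis unfolding Q_def by (intro exI[of _ b]) (simp add: e_def field_simps del: of_nat_Suc)
  qed
  then obtain g where g: "\<And>i. Q i (g i) (g (Suc i))"
    using dependent_nat_choice[of "\<lambda>_ _. True" Q] by auto
  then have "strict_mono g" by (auto simp: Q_def strict_mono_Suc_iff)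
  define A where "A = (\<Union>i. D i \<inter> {g i<..g (Suc i)})"
  have "upper_density A = 1"
    unfolding upper_density_eq_1_iff
  proof (intro allI impI)
    fix e :: real and n :: nat
    assume e: "e > 0"
    define i where "i = max n (nat \<lceil>1 / e\<rceil>)"
    have "1 / e \<le> real (Suc i)" unfolding i_def by linarith
    then have "1 / real (Suc i) \<le> e" using e by (simp add: field_simps)
    then have "(1 - e) * real (g (Suc i)) \<le> (1 - 1 / real (Suc i)) * real (g (Suc i))"
      by (intro mult_right_mono) auto
    also have "\<dots> < real (card (D i \<inter> {g i<..g (Suc i)}))" using g[of i] by (simp add: Q_def)
    also have "\<dots> \<le> real (card (A \<inter> {1..g (Suc i)}))"
      unfolding of_nat_le_iff by (intro card_mono) (auto simp: A_def)
    finally have "(1 - e) * real (g (Suc i)) < real (card (A \<inter> {1..g (Suc i)}))" .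
    moreover have "n < g (Suc i)"
      using strict_mono_imp_increasing[OF \<open>strict_mono g\<close>, of "Suc i"] by (simp add: i_def)
    ultimately show "\<exists>M>n. (1 - e) * real M < real (card (A \<inter> {1..M}))" by blast
  qed
  moreover have "\<forall>\<^sub>F k in seq_within A. k \<in> D n" for n
    unfolding eventually_seq_within
  proof (intro exI ballI impI)
    fix k assume "k \<in> A" "Suc (g n) \<le> k"
    then obtain i where i: "k \<in> D i" "k \<le> g (Suc i)" by (auto simp: A_def)
    with \<open>Suc (g n) \<le> k\<close> have "g n < g (Suc i)" by linarith
    then have "n \<le> i" using \<open>strict_mono g\<close> by (simp add: strict_mono_less)
    with i(1) dec show "k \<in> D n" by (auto dest: decseqD)
  qed
  ultimately show ?thesis using that by blast
qed

section \<open>The metric defined by a fundamental system of seminorms\<close>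

context
  fixes scl :: "'k::real_normed_field \<Rightarrow> 'a::ab_group_add \<Rightarrow> 'a" and q :: "'a \<Rightarrow> real"
  assumes vs: "vector_space scl" and q: "seminorm scl q"
begin

interpretation vector_space scl by (rule vs)

lemma seminorm_0: "q 0 = 0"
proof -
  have "q (scl 0 0) = norm (0 :: 'k) * q 0" using q unfolding seminorm_def by blast
  then show ?thesis by simp
qed

lemma seminorm_minus: "q (- x) = q x"
proof -
  have "q (scl (- 1) x) = norm (- 1 :: 'k) * q x" using q unfolding seminorm_def by blast
  then show ?thesis by simp
qed

lemma seminorm_diff_le: "q (x - y) \<le> q x + q y"
proof -
  have "q (x + - y) \<le> q x + q (- y)" using q unfolding seminorm_def by blast
  then show ?thesis by (simp add: seminorm_minus)
qed

lemma seminorm_nonneg: "0 \<le> q x"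
  using seminorm_diff_le[of x x] by (simp add: seminorm_0)

end

lemma dist_of_eq_dist_of_diff: "dist_of G x y = dist_of G (x - y) 0"
  by (cases G) simp_all

locale seminormed_space = vector_space scl
  for scl :: "'k::real_normed_field \<Rightarrow> 'a::{ab_group_add,t2_space} \<Rightarrow> 'a" +
  fixes p :: "nat \<Rightarrow> 'a \<Rightarrow> real"
  assumes fundamental: "fundamental_seminorms scl p"
begin

lemma p_triangle: "p n (x + y) \<le> p n x + p n y"
  and p_scale: "p n (scl c x) = norm c * p n x"
  and p_Suc: "p n x \<le> p (Suc n) x"
  and open_iff: "open U \<longleftrightarrow> (\<forall>x\<in>U. \<exists>n. \<exists>e>0. {y. p n (y - x) < e} \<subseteq> U)"
  using fundamental by (auto simp: fundamental_seminorms_def seminorm_def)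

lemma seminorm_p: "seminorm scl (p n)"
  using fundamental by (simp add: fundamental_seminorms_def)

lemmas p_0 [simp] = seminorm_0 [OF vector_space_axioms seminorm_p]
  and p_minus [simp] = seminorm_minus [OF vector_space_axioms seminorm_p]
  and p_nonneg [simp] = seminorm_nonneg [OF vector_space_axioms seminorm_p]

lemma p_diff_commute: "p n (x - y) = p n (y - x)"
  using p_minus[of n "x - y"] by simp

lemma p_mono: "m \<le> n \<Longrightarrow> p m x \<le> p n x"
  using lift_Suc_mono_le[of "\<lambda>n. p n x"] p_Suc by blast

lemma p_pos: assumes "x \<noteq> 0" shows "\<exists>n. p n x > 0"
proof -
  obtain U where U: "open U" "0 \<in> U" "x \<notin> U" using t1_space[of 0 x] assms by auto
  then obtain n e where "e > 0" "{y. p n (y - 0) < e} \<subseteq> U" using open_iff by blast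
  with U(3) have "\<not> p n x < e" by auto
  with \<open>e > 0\<close> show ?thesis by (meson less_le_trans not_less)
qed

lemma open_p_ball: "open {y. p n (y - x) < e}"
  unfolding open_iff
proof (intro ballI exI conjI)
  fix y assume y: "y \<in> {y. p n (y - x) < e}"
  then show "e - p n (y - x) > 0" by simp
  show "{z. p n (z - y) < e - p n (y - x)} \<subseteq> {y. p n (y - x) < e}"
  proof clarify
    fix z assume "p n (z - y) < e - p n (y - x)"
    with p_triangle[of n "z - y" "y - x"] show "p n (z - x) < e" by simp
  qed
qed

lemma tendsto_p_iff: "(f \<longlongrightarrow> l) F \<longleftrightarrow> (\<forall>n. \<forall>e>0. \<forall>\<^sub>F t in F. p n (f t - l) < e)"
proof
  assume f: "(f \<longlongrightarrow> l) F"
  show "\<forall>n. \<forall>e>0. \<forall>\<^sub>F t in F. p n (f t - l) < e"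
    using topological_tendstoD[OF f open_p_ball[of _ l]] by simp
next
  assume R: "\<forall>n. \<forall>e>0. \<forall>\<^sub>F t in F. p n (f t - l) < e"
  show "(f \<longlongrightarrow> l) F"
  proof (rule topological_tendstoI)
    fix U assume "open U" "l \<in> U"
    then obtain n e where "e > 0" "{y. p n (y - l) < e} \<subseteq> U" using open_iff by blast
    with R show "\<forall>\<^sub>F t in F. f t \<in> U" by (auto elim!: allE eventually_mono)
  qed
qed

lemma continuous_on_p: "continuous_on S (p n)"
  unfolding continuous_on_def
proof
  fix x
  have "\<bar>p n y - p n x\<bar> \<le> p n (y - x)" for y
    using p_triangle[of n "y - x" x] p_triangle[of n "x - y" y] p_diff_commute[of n x y] by simp
  moreover have "\<forall>\<^sub>F y in at x within S. p n (y - x) < e" if "e > 0" for e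
    using tendsto_ident_at[of x S] that unfolding tendsto_p_iff by simp
  ultimately have "\<forall>\<^sub>F y in at x within S. \<bar>p n y - p n x\<bar> < e" if "e > 0" for e
    using that by (blast intro: eventually_mono le_less_trans)
  then show "(p n \<longlongrightarrow> p n x) (at x within S)"
    by (simp add: tendsto_iff dist_real_def)
qed

lemma p_quotient_le_1: "p n x / (1 + p n x) \<le> 1"
  and p_quotient_le: "p n x / (1 + p n x) \<le> p n x"
proof -
  have "1 + p n x > 0" by (rule add_pos_nonneg) auto
  then show "p n x / (1 + p n x) \<le> 1" "p n x / (1 + p n x) \<le> p n x"
    by (simp_all add: pos_divide_le_eq algebra_simps)
qed

lemma summable_dist_of:
  "summable (\<lambda>n. (1/2) ^ Suc n * (p n (x - y) / (1 + p n (x - y))))"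
proof (rule summable_comparison_test')
  show "summable (\<lambda>n. (1/2::real) ^ Suc n)"
    by (simp add: summable_geometric)
  show "norm ((1/2) ^ Suc n * (p n (x - y) / (1 + p n (x - y)))) \<le> (1/2) ^ Suc n" for n
    unfolding norm_mult
    using p_quotient_le_1[of n "x - y"] by (intro mult_left_le[THEN order_trans]) (auto simp: add_nonneg_nonneg)
qed

lemma dist_of_nonneg: "0 \<le> dist_of (Seminorms p) x y"
  unfolding dist_of.simps by (intro suminf_nonneg summable_dist_of) (simp add: add_nonneg_nonneg)

lemma dist_of_ge:
  "(1/2) ^ Suc n * (p n (x - y) / (1 + p n (x - y))) \<le> dist_of (Seminorms p) x y"
proof -
  have "(\<Sum>i\<in>{n}. (1/2) ^ Suc i * (p i (x - y) / (1 + p i (x - y)))) \<le> dist_of (Seminorms p) x y"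
    unfolding dist_of.simps by (intro sum_le_suminf summable_dist_of) (auto simp: add_nonneg_nonneg)
  then show ?thesis by simp
qed

text \<open>The first \<open>n + 1\<close> terms are controlled by \<open>p n\<close>, the others by their weights.\<close>

lemma dist_of_le: "dist_of (Seminorms p) x y \<le> p n (x - y) + (1/2) ^ Suc n"
proof -
  let ?f = "\<lambda>i. (1/2) ^ Suc i * (p i (x - y) / (1 + p i (x - y)))"
  have geo: "(\<lambda>i. (1/2::real) ^ Suc i) sums 1" by (rule power_half_series)
  have tail: "(\<lambda>i. (1/2::real) ^ Suc (i + Suc n)) sums (1/2) ^ Suc n"
    using sums_mult[OF geo, of "(1/2) ^ Suc n"] by (simp add: power_add mult_ac)
  have f1: "?f i \<le> (1/2) ^ Suc i" for i
    by (intro mult_left_le p_quotient_le_1) auto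
  have f2: "?f i \<le> (1/2) ^ Suc i * p n (x - y)" if "i < Suc n" for i
  proof -
    have "p i (x - y) / (1 + p i (x - y)) \<le> p i (x - y)"
      by (rule p_quotient_le)
    also have "\<dots> \<le> p n (x - y)" using that by (intro p_mono) simp
    finally show ?thesis by (intro mult_left_mono) auto
  qed
  have "(\<Sum>i. ?f (i + Suc n)) \<le> (1/2) ^ Suc n"
    using suminf_le[OF f1 summable_ignore_initial_segment[OF summable_dist_of] sums_summable[OF tail]]
      sums_unique[OF tail] by simp
  moreover have "(\<Sum>i<Suc n. ?f i) \<le> p n (x - y)"
  proof -
    have "(\<Sum>i<Suc n. ?f i) \<le> (\<Sum>i<Suc n. (1/2) ^ Suc i * p n (x - y))"
      by (intro sum_mono f2) simp
    also have "\<dots> = (\<Sum>i<Suc n. (1/2) ^ Suc i) * p n (x - y)" by (rule sum_distrib_right[symmetric])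
    also have "\<dots> \<le> 1 * p n (x - y)"
      using sum_le_suminf[OF sums_summable[OF geo], of "{..<Suc n}"] sums_unique[OF geo]
      by (intro mult_right_mono) auto
    finally show ?thesis by simp
  qed
  ultimately show ?thesis
    unfolding dist_of.simps using suminf_split_initial_segment[OF summable_dist_of, of x y "Suc n"] by simp
qed

text \<open>
  The two estimates \<open>p_less_if_dist_of_less\<close> and \<open>ex_p_less_imp_dist_of_less\<close> compare the balls of
  the metric with those of the seminorms, uniformly in the centre.
\<close>

lemma p_less_if_dist_of_less:
  assumes e: "e > 0" and d: "dist_of (Seminorms p) x y < (1/2) ^ Suc n * (e / (1 + e))"
  shows "p n (x - y) < e"
proof (rule ccontr)
  assume "\<not> p n (x - y) < e"
  then have "e / (1 + e) \<le> p n (x - y) / (1 + p n (x - y))"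
    using e by (simp add: frac_le_eq field_simps)
  then have "(1/2) ^ Suc n * (e / (1 + e)) \<le> (1/2) ^ Suc n * (p n (x - y) / (1 + p n (x - y)))"
    by (intro mult_left_mono) auto
  also have "\<dots> \<le> dist_of (Seminorms p) x y" by (rule dist_of_ge)
  finally show False using d by simp
qed

lemma ex_p_less_imp_dist_of_less:
  assumes "e > 0"
  obtains n where "\<And>x y. p n (x - y) < e / 2 \<Longrightarrow> dist_of (Seminorms p) x y < e"
proof -
  obtain n where n: "(1/2::real) ^ n < e / 2" using real_arch_pow_inv[of "e/2" "1/2"] assms by auto
  have "(1/2::real) ^ Suc n \<le> (1/2) ^ n" by simp
  then have "dist_of (Seminorms p) x y < e" if "p n (x - y) < e / 2" for x y
    using dist_of_le[of x y n] that n by linarith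
  then show thesis by (rule that)
qed

sublocale dist: Metric_space UNIV "dist_of (Seminorms p)"
proof
  fix x y z
  show "0 \<le> dist_of (Seminorms p) x y" by (rule dist_of_nonneg)
  show "dist_of (Seminorms p) x y = dist_of (Seminorms p) y x"
    by (simp add: p_diff_commute[of _ x y])
  show "dist_of (Seminorms p) x y = 0 \<longleftrightarrow> x = y"
  proof
    assume 0: "dist_of (Seminorms p) x y = 0"
    have "p n (x - y) < e" if "e > 0" for n e
      using that by (intro p_less_if_dist_of_less) (auto simp: 0 simp del: dist_of.simps)
    then have "\<not> p n (x - y) > 0" for n by blast
    then show "x = y" using p_pos[of "x - y"] by auto
  qed simp
  show "dist_of (Seminorms p) x z \<le> dist_of (Seminorms p) x y + dist_of (Seminorms p) y z"
  proof -
    \<comment> \<open>The function \<open>t / (1 + t)\<close> is increasing and subadditive.\<close>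
    have *: "c / (1 + c) \<le> a / (1 + a) + b / (1 + b)" if "0 \<le> a" "0 \<le> b" "0 \<le> c" "c \<le> a + b" for a b c :: real
    proof -
      have "c / (1 + c) \<le> (a + b) / (1 + (a + b))"
        using that by (simp add: frac_le_eq field_simps)
      also have "\<dots> = a / (1 + (a + b)) + b / (1 + (a + b))" by (simp add: add_divide_distrib)
      also have "\<dots> \<le> a / (1 + a) + b / (1 + b)"
        using that by (intro add_mono divide_left_mono) auto
      finally show ?thesis .
    qed
    have "(1/2) ^ Suc n * (p n (x - z) / (1 + p n (x - z))) \<le>
      (1/2) ^ Suc n * (p n (x - y) / (1 + p n (x - y))) + (1/2) ^ Suc n * (p n (y - z) / (1 + p n (y - z)))" for n
      unfolding distrib_left[symmetric]
      using p_triangle[of n "x - y" "y - z"] by (intro mult_left_mono *) auto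
    then show ?thesis
      unfolding dist_of.simps suminf_add[OF summable_dist_of summable_dist_of]
      by (intro suminf_le summable_dist_of summable_add)
  qed
qed

lemma openin_dist_iff: "openin dist.mtopology U \<longleftrightarrow> open U"
proof
  assume U: "openin dist.mtopology U"
  show "open U"
    unfolding open_iff
  proof
    fix x assume "x \<in> U"
    with U obtain r where r: "r > 0" "dist.mball x r \<subseteq> U"
      unfolding dist.openin_mtopology by auto
    obtain n where n: "\<And>x y. p n (x - y) < r / 2 \<Longrightarrow> dist_of (Seminorms p) x y < r"
      using ex_p_less_imp_dist_of_less[OF r(1)] by metis
    with r n show "\<exists>n. \<exists>e>0. {y. p n (y - x) < e} \<subseteq> U"
      by (intro exI[of _ n] exI[of _ "r/2"]) (auto simp: p_diff_commute[of _ _ x] simp del: dist_of.simps)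
  qed
next
  assume U: "open U"
  show "openin dist.mtopology U"
    unfolding dist.openin_mtopology
  proof (intro conjI allI impI subset_UNIV)
    fix x assume "x \<in> U"
    with U obtain n e where e: "e > 0" "{y. p n (y - x) < e} \<subseteq> U" unfolding open_iff by blast
    have "dist.mball x ((1/2) ^ Suc n * (e / (1 + e))) \<subseteq> U"
    proof
      fix y assume "y \<in> dist.mball x ((1/2) ^ Suc n * (e / (1 + e)))"
      then have "dist_of (Seminorms p) y x < (1/2) ^ Suc n * (e / (1 + e))"
        by (simp add: dist.commute[of y x] del: dist_of.simps)
      with e show "y \<in> U" using p_less_if_dist_of_less[OF e(1)] by blast
    qed
    moreover have "(1/2) ^ Suc n * (e / (1 + e)) > 0" using e by simp
    ultimately show "\<exists>r>0. dist.mball x r \<subseteq> U" by blast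
  qed
qed

lemma mtopology_eq_euclidean: "dist.mtopology = euclidean"
  by (simp add: topology_eq openin_dist_iff)

end

text \<open>
  Completeness is given in terms of neighbourhoods of zero; it is completeness of the metric above,
  since that metric is translation invariant.
\<close>

lemma (in frechet_space) Baire_category:
  fixes \<G> :: "'a set set"
  assumes "countable \<G>" and "\<And>U. U \<in> \<G> \<Longrightarrow> open U \<and> closure U = UNIV"
  shows "closure (\<Inter>\<G>) = UNIV"
proof -
  obtain p where "fundamental_seminorms scl p" using ex_fundamental_seminorms by blast
  then interpret seminormed_space scl p by unfold_locales
  have "dist.mcomplete"
    unfolding dist.mcomplete_def
  proof (intro allI impI)
    fix u assume u: "dist.MCauchy u"
    have "convergent u"
    proof (rule complete, clarify)
      fix U :: "'a set" assume U: "open U" "0 \<in> U"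
      then obtain r where r: "r > 0" "dist.mball 0 r \<subseteq> U"
        unfolding openin_dist_iff[symmetric] dist.openin_mtopology by auto
      from u r obtain M where "\<And>i j. i \<ge> M \<Longrightarrow> j \<ge> M \<Longrightarrow> dist_of (Seminorms p) (u i) (u j) < r"
        unfolding dist.MCauchy_def by metis
      then have "u i - u j \<in> dist.mball 0 r" if "i \<ge> M" "j \<ge> M" for i j
        unfolding dist.in_mball using that dist_of_eq_dist_of_diff[of "Seminorms p" "u i" "u j"] dist.commute[of 0 "u i - u j"] by simp
      with r show "\<exists>M. \<forall>i\<ge>M. \<forall>j\<ge>M. u i - u j \<in> U" by blast
    qed
    then show "\<exists>x. limitin dist.mtopology u x sequentially"
      by (simp add: mtopology_eq_euclidean convergent_def)
  qed
  moreover have "openin dist.mtopology U \<and> dist.mtopology closure_of U = UNIV" if "U \<in> \<G>" for U :: "'a set"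
    using assms(2)[OF that] by (simp add: mtopology_eq_euclidean)
  ultimately have "dist.mtopology closure_of \<Inter>\<G> = UNIV"
    by (intro dist.metric_Baire_category[OF _ assms(1)])
  then show ?thesis by (simp add: mtopology_eq_euclidean)
qed

section \<open>Generic visits to open sets\<close>

lemma open_card_gt:
  assumes "finite I" and "\<And>k. k \<in> I \<Longrightarrow> open (V k)"
  shows "open {x. c < real (card {k\<in>I. x \<in> V k})}"
proof -
  have "{x. c < real (card {k\<in>I. x \<in> V k})} =
      (\<Union>F\<in>{F. F \<subseteq> I \<and> c < real (card F)}. \<Inter>k\<in>F. V k)" (is "?L = ?R")
  proof
    show "?L \<subseteq> ?R"
    proof
      fix x assume "x \<in> ?L"
      then show "x \<in> ?R" by (intro UN_I[of "{k\<in>I. x \<in> V k}"]) auto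
    qed
    show "?R \<subseteq> ?L"
    proof clarify
      fix x F assume F: "F \<subseteq> I" "c < real (card F)" "x \<in> (\<Inter>k\<in>F. V k)"
      then have "card F \<le> card {k\<in>I. x \<in> V k}"
        using assms(1) by (intro card_mono) auto
      with F(2) show "c < real (card {k\<in>I. x \<in> V k})" by linarith
    qed
  qed
  also have "open \<dots>"
    using assms by (intro open_UN ballI open_INT) (auto intro: finite_subset)
  finally show ?thesis .
qed

text \<open>
  The vectors with an almost full stretch beyond \<open>n\<close> form an open set, which the last assumption
  makes dense; so the conclusion even holds on a dense \<open>G\<^sub>\<delta>\<close> set.
\<close>

lemma (in frechet_space) ex_upper_density_1:
  fixes \<V> :: "(nat \<Rightarrow> 'a set) set"
  assumes "countable \<V>"
    and V: "\<And>V k. V \<in> \<V> \<Longrightarrow> k \<ge> 1 \<Longrightarrow> open (V k)"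
    and meets: "\<And>V e n U. V \<in> \<V> \<Longrightarrow> e > 0 \<Longrightarrow> open U \<Longrightarrow> U \<noteq> {} \<Longrightarrow>
      \<exists>x\<in>U. \<exists>M>n. (1 - e) * real M < real (card ({k. x \<in> V k} \<inter> {1..M}))"
  obtains x where "\<And>V. V \<in> \<V> \<Longrightarrow> upper_density {k. x \<in> V k} = 1"
proof -
  \<comment> \<open>One index \<open>i\<close> serves both as tolerance \<open>1 / (i + 1)\<close> and as lower bound for the stretch.\<close>
  define E where "E = (\<lambda>(V, i). \<Union>M\<in>{i<..}.
    {x :: 'a. (1 - 1 / real (Suc i)) * real M < real (card {k \<in> {1..M}. x \<in> V k})})"
  have eq: "{k. x \<in> V k} \<inter> {1..M} = {k \<in> {1..M}. x \<in> V k}" for x V M by auto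
  have "open (E (V, i)) \<and> closure (E (V, i)) = UNIV" if "V \<in> \<V>" for V i
  proof
    show "open (E (V, i))"
      unfolding E_def prod.case by (intro open_UN ballI open_card_gt finite_atLeastAtMost V[OF that]) simp
    have "U \<inter> E (V, i) \<noteq> {}" if U: "open U" "U \<noteq> {}" for U
    proof -
      obtain x M where "x \<in> U" "M > i" "(1 - 1 / real (Suc i)) * real M < real (card {k \<in> {1..M}. x \<in> V k})"
        using meets[OF \<open>V \<in> \<V>\<close> _ U, of "1 / real (Suc i)" i] unfolding eq by auto
      then have "x \<in> U \<inter> E (V, i)" unfolding E_def by blast
      then show ?thesis by blast
    qed
    then show "closure (E (V, i)) = UNIV"
      unfolding closure_interior
      by (metis Compl_eq_Diff_UNIV Diff_empty disjoint_eq_subset_Compl inf.commute interior_subset open_interior)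
  qed
  then have "closure (\<Inter> (E ` (\<V> \<times> UNIV))) = UNIV"
    using \<open>countable \<V>\<close> by (intro Baire_category) auto
  then obtain x where x: "x \<in> \<Inter> (E ` (\<V> \<times> UNIV))" by (metis UNIV_not_empty closure_empty ex_in_conv)
  have "upper_density {k. x \<in> V k} = 1" if "V \<in> \<V>" for V
    unfolding upper_density_eq_1_iff
  proof (intro allI impI)
    fix e :: real and n :: nat
    assume e: "e > 0"
    define i where "i = max n (nat \<lceil>1 / e\<rceil>)"
    have "1 / e \<le> real (Suc i)" unfolding i_def by linarith
    then have *: "1 / real (Suc i) \<le> e" using e by (simp add: field_simps)
    have "x \<in> E (V, i)" using x that by blast
    then obtain M where M: "M > i" "(1 - 1 / real (Suc i)) * real M < real (card {k \<in> {1..M}. x \<in> V k})"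
      unfolding E_def by auto
    have "(1 - e) * real M \<le> (1 - 1 / real (Suc i)) * real M"
      using * by (intro mult_right_mono) auto
    with M have "(1 - e) * real M < real (card ({k. x \<in> V k} \<inter> {1..M}))"
      unfolding eq by linarith
    moreover have "M > n" using M(1) by (simp add: i_def)
    ultimately show "\<exists>M>n. (1 - e) * real M < real (card ({k. x \<in> V k} \<inter> {1..M}))" by blast
  qed
  then show thesis by (rule that)
qed

section \<open>Perturbations with large seminorms\<close>

text \<open>
  Double counting of the bad pairs \<open>(i, k)\<close>: an index \<open>k\<close> outside the exceptional set \<open>H\<close> is bad
  for at most \<open>N\<close> values of \<open>i\<close>, an index in \<open>H\<close> for at most all \<open>K\<close> of them.  Some \<open>i\<close> has at
  most the average number of bad \<open>k\<close>.
\<close>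

lemma ex_index_few_bad:
  fixes K N :: nat
  assumes "finite I" "K > 0" and few: "\<And>k. k \<in> I - H \<Longrightarrow> card {i\<in>{..<K}. B i k} \<le> N"
  shows "\<exists>i<K. K * card {k\<in>I. B i k} \<le> N * card I + K * card (I \<inter> H)"
proof (rule ccontr)
  let ?R = "N * card I + K * card (I \<inter> H)"
  assume "\<not> (\<exists>i<K. K * card {k\<in>I. B i k} \<le> ?R)"
  then have "(\<Sum>i<K. ?R) < (\<Sum>i<K. K * card {k\<in>I. B i k})"
    using \<open>K > 0\<close> by (intro sum_strict_mono) (auto simp: not_le)
  then have "K * ?R < K * (\<Sum>i<K. card {k\<in>I. B i k})" by (simp add: sum_distrib_left)
  also have "(\<Sum>i<K. card {k\<in>I. B i k}) = (\<Sum>k\<in>I. card {i\<in>{..<K}. B i k})"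
    using \<open>finite I\<close> by (intro sum_multicount_gen) auto
  also have "\<dots> \<le> (\<Sum>k\<in>I. N + (if k \<in> H then K else 0))"
  proof (rule sum_mono)
    fix k assume "k \<in> I"
    have "card {i\<in>{..<K}. B i k} \<le> card {..<K}" by (intro card_mono) auto
    with few[of k] \<open>k \<in> I\<close> show "card {i\<in>{..<K}. B i k} \<le> N + (if k \<in> H then K else 0)" by auto
  qed
  also have "\<dots> = ?R"
    using \<open>finite I\<close> by (simp add: sum.distrib sum.If_cases Int_def)
  finally show False by simp
qed

text \<open>
  The density statement for the second family of open sets.  It concerns only the seminorms
  \<open>h j k = q m \<circ> T j k\<close> on \<open>X\<close>.
\<close>

lemma (in seminormed_space) ex_seminorms_large:
  fixes h :: "nat \<Rightarrow> nat \<Rightarrow> 'a \<Rightarrow> real"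
  assumes "finite J" and h: "\<And>j k. j \<in> J \<Longrightarrow> k \<ge> 1 \<Longrightarrow> seminorm scl (h j k)"
    and y: "y \<longlonglongrightarrow> 0" and "\<epsilon> > 0" and M: "strict_mono_on {1..} M"
    and large: "\<And>l. l \<ge> 1 \<Longrightarrow>
      real (M l) * (1 - 1 / real l) \<le> real (card {k \<in> {1..M l}. \<forall>j\<in>J. h j k (y l) > \<epsilon>})"
    and U: "open U" "x0 \<in> U" and "e > 0" "C \<ge> 0"
  shows "\<exists>x\<in>U. \<exists>L>n. (1 - e) * real L < real (card ({k. \<forall>j\<in>J. h j k x > C} \<inter> {1..L}))"
proof -
  obtain s r where r: "r > 0" "{z. p s (z - x0) < r} \<subseteq> U" using U open_iff by blast
  \<comment> \<open>So many translates that \<open>card J / K < e / 2\<close>; the index \<open>l\<close> below spends the other half of \<open>e\<close>.\<close>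
  define K where "K = Suc (nat \<lceil>2 * real (card J) / e\<rceil>)"
  have "2 * real (card J) / e < real K" unfolding K_def by linarith
  then have K: "K > 0" "2 * real (card J) < e * real K"
    using \<open>e > 0\<close> by (simp_all add: K_def field_simps)
  \<comment> \<open>Steps of size \<open>a\<close> separate the translates: two vectors with \<open>h j k \<le> C\<close> differ by at most
    \<open>2 * C\<close>, but \<open>h j k (scl a (y l)) > 2 * (C + 1)\<close>.\<close>
  define a where "a = 2 * (C + 1) / \<epsilon>"
  have a: "a > 0" "a * \<epsilon> = 2 * (C + 1)" using \<open>C \<ge> 0\<close> \<open>\<epsilon> > 0\<close> by (simp_all add: a_def)
  have "\<forall>\<^sub>F l in sequentially. p s (y l) < r / (real K * a)"
    using y r a K unfolding tendsto_p_iff by simp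
  moreover have "\<forall>\<^sub>F l in sequentially. l \<ge> max (n + 2) (nat \<lceil>2 / e\<rceil> + 1)"
    by (rule eventually_ge_at_top)
  ultimately have "\<forall>\<^sub>F l in sequentially. p s (y l) < r / (real K * a) \<and> l \<ge> max (n + 2) (nat \<lceil>2 / e\<rceil> + 1)"
    by (rule eventually_conj)
  then obtain l where l: "p s (y l) < r / (real K * a)" "l \<ge> n + 2" "l \<ge> nat \<lceil>2 / e\<rceil> + 1"
    by (auto simp: eventually_sequentially)
  have "2 / e < real l" using l(3) by linarith
  then have le: "1 / real l < e / 2" using \<open>e > 0\<close> l(2) by (simp add: field_simps)
  \<comment> \<open>\<open>M\<close> is increasing only from index 1 on, hence the shift by one.\<close>
  have "i \<le> M (Suc i)" for i
  proof (induction i)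
    case (Suc i)
    have "M (Suc i) < M (Suc (Suc i))" using M by (auto simp: strict_mono_on_def)
    with Suc show ?case by simp
  qed simp
  from this[of "l - 1"] l(2) have Ml: "M l > n" by simp
  define I where "I = {1..M l}"
  define H where "H = {k. \<not> (\<forall>j\<in>J. h j k (y l) > \<epsilon>)}"
  define z where "z = (\<lambda>i. x0 + scl (of_real (real i * a)) (y l))"
  define B where "B = (\<lambda>i k. \<exists>j\<in>J. h j k (z i) \<le> C)"
  have zU: "z i \<in> U" if "i < K" for i
  proof -
    have "p s (z i - x0) = real i * a * p s (y l)"
      using a by (simp add: z_def p_scale abs_mult del: of_real_mult)
    also have "\<dots> \<le> real K * a * p s (y l)"
      using that a by (intro mult_right_mono) auto
    also have "\<dots> < r" using l(1) K a by (simp add: pos_less_divide_eq mult.commute)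
    finally show ?thesis using r by blast
  qed
  have "card {i\<in>{..<K}. B i k} \<le> card J" if k: "k \<in> I - H" for k
  proof -
    have "card {i\<in>{..<K}. h j k (z i) \<le> C} \<le> 1" if "j \<in> J" for j
    proof -
      have sn: "seminorm scl (h j k)" using h[OF that] k by (simp add: I_def)
      have y_large: "h j k (y l) > \<epsilon>" using k that by (simp add: H_def)
      have "i = i'" if "h j k (z i) \<le> C" "h j k (z i') \<le> C" for i i'
      proof (rule ccontr)
        assume "i \<noteq> i'"
        then have 1: "1 \<le> \<bar>real i - real i'\<bar>" by linarith
        have "z i - z i' = scl (of_real ((real i - real i') * a)) (y l)"
          unfolding z_def by (simp add: scale_left_diff_distrib[symmetric] left_diff_distrib)
        then have "h j k (z i - z i') = norm (of_real ((real i - real i') * a) :: 'k) * h j k (y l)"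
          using sn by (simp add: seminorm_def)
        also have "\<dots> = \<bar>real i - real i'\<bar> * (a * h j k (y l))"
          using a by (simp add: abs_mult del: of_real_mult)
        finally have "\<bar>real i - real i'\<bar> * (a * h j k (y l)) \<le> 2 * C"
          using seminorm_diff_le[OF vector_space_axioms sn, of "z i" "z i'"] that by simp
        moreover have "2 * (C + 1) \<le> a * h j k (y l)"
          unfolding a(2)[symmetric] using a y_large by (intro mult_left_mono) auto
        moreover have "1 * (a * h j k (y l)) \<le> \<bar>real i - real i'\<bar> * (a * h j k (y l))"
          using 1 a seminorm_nonneg[OF vector_space_axioms sn] by (intro mult_right_mono) auto
        ultimately show False by simp
      qed
      then show ?thesis by (subst One_nat_def, subst card_le_Suc0_iff_eq) auto
    qed
    then have "(\<Sum>j\<in>J. card {i\<in>{..<K}. h j k (z i) \<le> C}) \<le> (\<Sum>j\<in>J. 1)"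
      by (intro sum_mono)
    moreover have "{i\<in>{..<K}. B i k} = (\<Union>j\<in>J. {i\<in>{..<K}. h j k (z i) \<le> C})"
      by (auto simp: B_def)
    ultimately show ?thesis
      using card_UN_le[OF \<open>finite J\<close>, of "\<lambda>j. {i\<in>{..<K}. h j k (z i) \<le> C}"] by simp
  qed
  then obtain i where i: "i < K" "K * card {k\<in>I. B i k} \<le> card J * card I + K * card (I \<inter> H)"
    using ex_index_few_bad[of I K H B "card J"] K(1) by (auto simp: I_def)
  have "card (I \<inter> H) + card {k \<in> {1..M l}. \<forall>j\<in>J. h j k (y l) > \<epsilon>} = card I"
  proof -
    have "{k \<in> {1..M l}. \<forall>j\<in>J. h j k (y l) > \<epsilon>} = I - H" by (auto simp: I_def H_def)
    then show ?thesis using card_Int_Diff[of I H] by (simp add: I_def)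
  qed
  with large[of l] l(2) have "real (card (I \<inter> H)) \<le> real (M l) * (1 / real l)"
    by (simp add: I_def algebra_simps)
  also have "\<dots> \<le> real (M l) * (e / 2)" using le by (intro mult_left_mono) auto
  finally have H: "real K * real (card (I \<inter> H)) \<le> real K * (real (M l) * (e / 2))"
    by (intro mult_left_mono) auto
  have "real K * real (card {k\<in>I. B i k}) \<le> real (card J) * real (M l) + real K * real (card (I \<inter> H))"
    using i(2) by (simp add: I_def flip: of_nat_mult of_nat_add)
  also have "\<dots> < e * real K / 2 * real (M l) + real K * (real (M l) * (e / 2))"
    using H K(2) Ml by (intro add_less_le_mono mult_strict_right_mono) auto
  also have "\<dots> = real K * (e * real (M l))" by simp
  finally have bad: "real (card {k\<in>I. B i k}) < e * real (M l)" using K(1) by simp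
  have "card {k\<in>I. B i k} + card ({k. \<forall>j\<in>J. h j k (z i) > C} \<inter> {1..M l}) = card I"
  proof -
    have "{k\<in>I. B i k} = I \<inter> {k. B i k}"
      and "{k. \<forall>j\<in>J. h j k (z i) > C} \<inter> {1..M l} = I - {k. B i k}"
      by (auto simp: I_def B_def not_le)
    then show ?thesis using card_Int_Diff[of I "{k. B i k}"] by (simp add: I_def)
  qed
  with bad have "(1 - e) * real (M l) < real (card ({k. \<forall>j\<in>J. h j k (z i) > C} \<inter> {1..M l}))"
    by (simp add: I_def algebra_simps)
  with zU[OF i(1)] Ml show ?thesis by blast
qed

section \<open>Irregular vectors and chaos\<close>

text \<open>
  A norm counts as a constant sequence of seminorms, so that everything except the metric itself
  treats both kinds of data for \<open>Y\<close> alike.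
\<close>

lemma fundamental_seminorm_of:
  assumes "induces_topology scl G"
  shows "fundamental_seminorms scl (seminorm_of G)"
proof (cases G)
  case (Seminorms p)
  moreover have "seminorm_of (Seminorms p) = p" by (intro ext) simp
  ultimately show ?thesis using assms by simp
next
  case (Norm q)
  then have "seminorm_of G = (\<lambda>_. q)" by (intro ext) simp
  then show ?thesis using assms Norm by (simp add: topology_norm_def fundamental_seminorms_def)
qed

lemma eventually_dist_of_less:
  fixes scl :: "'k::real_normed_field \<Rightarrow> 'b::{ab_group_add,t2_space} \<Rightarrow> 'b"
  assumes "vector_space scl" "induces_topology scl G" "(f \<longlongrightarrow> 0) F" "e > 0"
  shows "\<forall>\<^sub>F t in F. dist_of G (f t) 0 < e"
proof -
  interpret seminormed_space scl "seminorm_of G"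
    using assms(1) fundamental_seminorm_of[OF assms(2)]
    by (simp add: seminormed_space_def seminormed_space_axioms_def)
  have f: "\<forall>\<^sub>F t in F. seminorm_of G n (f t - 0) < e'" if "e' > 0" for n e'
    using assms(3) that unfolding tendsto_p_iff by blast
  show ?thesis
  proof (cases G)
    case (Seminorms p)
    then have p: "seminorm_of G = p" by (intro ext) simp
    obtain n where "\<And>x y. seminorm_of G n (x - y) < e / 2 \<Longrightarrow> dist_of (Seminorms p) x y < e"
      using ex_p_less_imp_dist_of_less[OF \<open>e > 0\<close>] unfolding p by metis
    then show ?thesis
      using f[of "e/2" n] \<open>e > 0\<close> Seminorms by (auto elim!: eventually_mono simp del: dist_of.simps)
  next
    case (Norm q)
    then show ?thesis using f[OF \<open>e > 0\<close>] by simp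
  qed
qed

lemma dist_of_ge_if_seminorm_of_ge_1:
  fixes scl :: "'k::real_normed_field \<Rightarrow> 'b::{ab_group_add,t2_space} \<Rightarrow> 'b"
  assumes "vector_space scl" "induces_topology scl G" "seminorm_of G m z \<ge> 1"
  shows "(1/2) ^ Suc (Suc m) \<le> dist_of G z 0"
proof (cases G)
  case (Seminorms p)
  interpret seminormed_space scl p
    using assms(1,2) Seminorms
    by (simp add: seminormed_space_def seminormed_space_axioms_def)
  have "1 / 2 \<le> p m z / (1 + p m z)"
    using assms(3) Seminorms by (simp add: field_simps)
  then have "(1/2) ^ Suc m * (1/2) \<le> (1/2) ^ Suc m * (p m z / (1 + p m z))"
    by (intro mult_left_mono) auto
  also have "\<dots> \<le> dist_of (Seminorms p) z 0" using dist_of_ge[of m z 0] by simp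
  finally show ?thesis using Seminorms by (simp del: dist_of.simps)
next
  case (Norm q)
  have "(1/2::real) ^ Suc (Suc m) \<le> 1" by (rule power_le_one) auto
  then show ?thesis using Norm assms(3) by (simp del: power_Suc)
qed

text \<open>
  The scrambled set is \<open>{t x | t real}\<close>: for \<open>s \<noteq> t\<close> the difference of the images is \<open>(s - t) T j k x\<close>,
  which tends to zero along \<open>A\<close>, while its \<open>m\<close>-th seminorm tends to infinity along \<open>B\<close>.  Once that
  seminorm is at least one, the distance is bounded below by a constant that depends only on \<open>m\<close>.
\<close>

lemma irregular_imp_chaotic:
  fixes scaleX :: "'k::real_normed_field \<Rightarrow> 'a::ab_group_add \<Rightarrow> 'a"
    and scaleY :: "'k \<Rightarrow> 'b::{ab_group_add,t2_space} \<Rightarrow> 'b"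
  assumes G: "induces_topology scaleY G"
    and T: "\<And>j k. j \<in> {1..N} \<Longrightarrow> k \<ge> 1 \<Longrightarrow> Vector_Spaces.linear scaleX scaleY (T j k)"
    and "vector_space scaleX" "vector_space scaleY"
    and irregular: "distributionally_irregular G N T x"
  shows "distributionally_chaotic G N T"
proof -
  interpret X: vector_space scaleX by fact
  interpret Y: vector_space scaleY by fact
  interpret Y: seminormed_space scaleY "seminorm_of G"
    using \<open>vector_space scaleY\<close> fundamental_seminorm_of[OF G]
    by (simp add: seminormed_space_def seminormed_space_axioms_def)
  obtain A B m where "x \<noteq> 0"
    and A: "upper_density A = 1" "\<And>j. j \<in> {1..N} \<Longrightarrow> ((\<lambda>k. T j k x) \<longlongrightarrow> 0) (seq_within A)"
    and B: "upper_density B = 1"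
      "\<And>j. j \<in> {1..N} \<Longrightarrow> filterlim (\<lambda>k. seminorm_of G m (T j k x)) at_top (seq_within B)"
    using irregular unfolding distributionally_irregular_def by blast
  define v where "v = (\<lambda>t::real. scaleX (of_real t) x)"
  have "inj v"
    using \<open>x \<noteq> 0\<close> by (intro injI) (simp add: v_def)
  then have "uncountable (range v)"
    using uncountable_UNIV_real by (metis countable_image_inj_on)
  moreover
  have pos: "\<forall>\<^sub>F k in seq_within D. k \<ge> 1" for D by (auto simp: eventually_seq_within)
  have diff: "T j k (v s) - T j k (v t) = scaleY (of_real (s - t)) (T j k x)"
    if "j \<in> {1..N}" "k \<ge> 1" for j k s t
  proof -
    interpret Vector_Spaces.linear scaleX scaleY "T j k" by (rule T[OF that])
    show ?thesis by (simp add: v_def scale Y.scale_left_diff_distrib)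
  qed
  have "upper_density (\<Inter>j\<in>{1..N}. {k. dist_of G (T j k (v s)) (T j k (v t)) \<ge> (1/2) ^ Suc (Suc m)}) = 1"
    if "v s \<noteq> v t" for s t
  proof -
    from that have "s \<noteq> t" by auto
    have "\<forall>\<^sub>F k in seq_within B. dist_of G (T j k (v s)) (T j k (v t)) \<ge> (1/2) ^ Suc (Suc m)"
      if j: "j \<in> {1..N}" for j
    proof -
      have "\<forall>\<^sub>F k in seq_within B. 1 / \<bar>s - t\<bar> \<le> seminorm_of G m (T j k x)"
        using B(2)[OF j] unfolding filterlim_at_top by blast
      then show ?thesis
        using pos[of B]
      proof eventually_elim
        case (elim k)
        have "seminorm_of G m (T j k (v s) - T j k (v t)) = \<bar>s - t\<bar> * seminorm_of G m (T j k x)"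
          using diff[OF j elim(2)] by (simp add: Y.p_scale del: of_real_diff)
        moreover have "1 \<le> \<bar>s - t\<bar> * seminorm_of G m (T j k x)"
          using elim(1) \<open>s \<noteq> t\<close> by (simp add: field_simps)
        ultimately show ?case
          unfolding dist_of_eq_dist_of_diff[of G "T j k (v s)"]
          by (intro dist_of_ge_if_seminorm_of_ge_1[OF \<open>vector_space scaleY\<close> G]) simp
      qed
    qed
    then have "\<forall>\<^sub>F k in seq_within B. \<forall>j\<in>{1..N}. dist_of G (T j k (v s)) (T j k (v t)) \<ge> (1/2) ^ Suc (Suc m)"
      by (intro eventually_ball_finite) auto
    from upper_density_eventually[OF B(1) this] show ?thesis
      by (simp add: Collect_ball_eq)
  qed
  moreover
  have "upper_density (\<Inter>j\<in>{1..N}. {k. dist_of G (T j k (v s)) (T j k (v t)) < e}) = 1"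
    if "e > 0" for s t e
  proof -
    have "\<forall>\<^sub>F k in seq_within A. dist_of G (T j k (v s)) (T j k (v t)) < e" if j: "j \<in> {1..N}" for j
    proof -
      have "((\<lambda>k. scaleY (of_real (s - t)) (T j k x)) \<longlongrightarrow> 0) (seq_within A)"
        unfolding Y.tendsto_p_iff
      proof (intro allI impI)
        fix n and c :: real assume "c > 0"
        have "c / (\<bar>s - t\<bar> + 1) > 0" using \<open>c > 0\<close> by (intro divide_pos_pos) auto
        then have "\<forall>\<^sub>F k in seq_within A. seminorm_of G n (T j k x - 0) < c / (\<bar>s - t\<bar> + 1)"
          using A(2)[OF j] unfolding Y.tendsto_p_iff by blast
        then show "\<forall>\<^sub>F k in seq_within A. seminorm_of G n (scaleY (of_real (s - t)) (T j k x) - 0) < c"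
        proof eventually_elim
          case (elim k)
          have "\<bar>s - t\<bar> * seminorm_of G n (T j k x) \<le> (\<bar>s - t\<bar> + 1) * seminorm_of G n (T j k x)"
            by (intro mult_right_mono) auto
          also have "\<dots> < c" using elim by (simp add: pos_less_divide_eq mult.commute)
          finally show ?case by (simp add: Y.p_scale del: of_real_diff)
        qed
      qed
      from eventually_dist_of_less[OF \<open>vector_space scaleY\<close> G this \<open>e > 0\<close>] pos[of A]
      show ?thesis
        by eventually_elim (simp add: dist_of_eq_dist_of_diff[of G "T j _ (v s)"] diff[OF j])
    qed
    then have "\<forall>\<^sub>F k in seq_within A. \<forall>j\<in>{1..N}. dist_of G (T j k (v s)) (T j k (v t)) < e"
      by (intro eventually_ball_finite) auto
    from upper_density_eventually[OF A(1) this] show ?thesis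
      by (simp add: Collect_ball_eq)
  qed
  ultimately show ?thesis
    unfolding distributionally_chaotic_def
    by (intro exI[of _ "range v"] exI[of _ "(1/2) ^ Suc (Suc m)"])
       (auto simp del: power_Suc One_nat_def)
qed

theorem theorem4p1:
  fixes scaleX :: "'k::real_normed_field \<Rightarrow> 'a::{ab_group_add,t2_space} \<Rightarrow> 'a"
    and scaleY :: "'k \<Rightarrow> 'b::{ab_group_add,t2_space} \<Rightarrow> 'b"
    and G :: "'b metric_data"
    and N :: nat
    and T :: "nat \<Rightarrow> nat \<Rightarrow> 'a \<Rightarrow> 'b"
  assumes "frechet_space scaleX" and "\<exists>x::'a. x \<noteq> 0"
    and "frechet_space scaleY" and "\<exists>y::'b. y \<noteq> 0"
    and "induces_topology scaleY G"
    and "N \<ge> 2"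
    and "\<And>j k. j \<in> {1..N} \<Longrightarrow> k \<ge> 1 \<Longrightarrow> T j k \<in> continuous_linear_operators scaleX scaleY"
    and "\<exists>X0. module.subspace scaleX X0 \<and> closure X0 = UNIV \<and>
           (\<forall>x\<in>X0. \<exists>A. upper_density A = 1 \<and>
              (\<forall>j\<in>{1..N}. ((\<lambda>k. T j k x) \<longlongrightarrow> 0) (seq_within A)))"
    and "\<exists>(y :: nat \<Rightarrow> 'a) (\<epsilon> :: real) (M :: nat \<Rightarrow> nat) (m :: nat).
           y \<longlonglongrightarrow> 0 \<and> \<epsilon> > 0 \<and> strict_mono_on {1..} M \<and> (\<forall>l\<ge>1. M l \<ge> 1) \<and>
           (\<forall>l\<ge>1. real (card {k \<in> {1..M l}. \<forall>j\<in>{1..N}. seminorm_of G m (T j k (y l)) > \<epsilon>})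
                     \<ge> real (M l) * (1 - 1 / real l))"
  shows "(\<exists>x. distributionally_irregular G N T x) \<and> distributionally_chaotic G N T"
proof -
  interpret X: frechet_space scaleX by fact
  interpret Yf: frechet_space scaleY by fact
  obtain p where p: "fundamental_seminorms scaleX p" using X.ex_fundamental_seminorms by blast
  interpret X: seminormed_space scaleX p using p by unfold_locales
  interpret Y: seminormed_space scaleY "seminorm_of G"
    using fundamental_seminorm_of[OF assms(5)] by unfold_locales
  have lin: "Vector_Spaces.linear scaleX scaleY (T j k)"
    and cont: "continuous_on UNIV (T j k)" if "j \<in> {1..N}" "k \<ge> 1" for j k
    using assms(7)[OF that] by (auto simp: continuous_linear_operators_def)
  have sn: "seminorm scaleX (\<lambda>x. seminorm_of G m (T j k x))" if "j \<in> {1..N}" "k \<ge> 1" for j k m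
  proof -
    interpret Vector_Spaces.linear scaleX scaleY "T j k" by (rule lin[OF that])
    show ?thesis by (simp add: seminorm_def add scale Y.p_triangle Y.p_scale)
  qed
  obtain X0 where X0: "closure X0 = UNIV"
    "\<And>x. x \<in> X0 \<Longrightarrow> \<exists>A. upper_density A = 1 \<and>
       (\<forall>j\<in>{1..N}. ((\<lambda>k. T j k x) \<longlongrightarrow> 0) (seq_within A))"
    using assms(8) by blast
  obtain y \<epsilon> M m where y: "y \<longlonglongrightarrow> 0" "\<epsilon> > 0" "strict_mono_on {1..} M"
    "\<And>l. l \<ge> 1 \<Longrightarrow> real (M l) * (1 - 1 / real l) \<le>
       real (card {k \<in> {1..M l}. \<forall>j\<in>{1..N}. seminorm_of G m (T j k (y l)) > \<epsilon>})"
    using assms(9) by blast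
  define V where "V = (\<lambda>n k. {x. \<forall>j\<in>{1..N}. seminorm_of G n (T j k x) < 1 / real (Suc n)})"
  define W where "W = (\<lambda>n k. {x. \<forall>j\<in>{1..N}. seminorm_of G m (T j k x) > real n})"
  have cont_q: "continuous_on UNIV (\<lambda>x. seminorm_of G n (T j k x))"
    if "j \<in> {1..N}" "k \<ge> 1" for n j k
    by (rule continuous_on_compose2[OF Y.continuous_on_p cont[OF that] subset_UNIV])
  have openV: "open (V n k)" if "k \<ge> 1" for n k
    unfolding V_def Collect_ball_eq using that
    by (intro open_INT finite_atLeastAtMost ballI open_Collect_less cont_q continuous_on_const) auto
  have openW: "open (W n k)" if "k \<ge> 1" for n k
    unfolding W_def Collect_ball_eq using that
    by (intro open_INT finite_atLeastAtMost ballI open_Collect_less cont_q continuous_on_const) auto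
  have denseV: "\<exists>x\<in>U. \<exists>L>i. (1 - e) * real L < real (card ({k. x \<in> V n k} \<inter> {1..L}))"
    if e: "e > 0" and U: "open U" "U \<noteq> {}" for e i n U
  proof -
    obtain x where x: "x \<in> U" "x \<in> X0"
      using open_Int_closure_eq_empty[OF U(1), of X0] X0(1) U(2) by auto
    obtain A where A: "upper_density A = 1"
      "\<And>j. j \<in> {1..N} \<Longrightarrow> ((\<lambda>k. T j k x) \<longlongrightarrow> 0) (seq_within A)"
      using X0(2)[OF x(2)] by blast
    have "\<forall>\<^sub>F k in seq_within A. seminorm_of G n (T j k x) < 1 / real (Suc n)" if "j \<in> {1..N}" for j
      using A(2)[OF that] unfolding Y.tendsto_p_iff by (auto dest!: spec[of _ n] spec[of _ "1 / real (Suc n)"])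
    then have "\<forall>\<^sub>F k in seq_within A. x \<in> V n k"
      unfolding V_def mem_Collect_eq by (intro eventually_ball_finite) auto
    from upper_density_eventually[OF A(1) this] e x(1) show ?thesis
      unfolding upper_density_eq_1_iff by blast
  qed
  have denseW: "\<exists>x\<in>U. \<exists>L>i. (1 - e) * real L < real (card ({k. x \<in> W n k} \<inter> {1..L}))"
    if e: "e > 0" and U: "open U" "U \<noteq> {}" for e i n U
  proof -
    obtain x0 where "x0 \<in> U" using U by blast
    from X.ex_seminorms_large[of "{1..N}" "\<lambda>j k x. seminorm_of G m (T j k x)", OF _ sn y U(1) this e]
    show ?thesis unfolding W_def by simp
  qed
  obtain x where "\<And>V'. V' \<in> range V \<union> range W \<Longrightarrow> upper_density {k. x \<in> V' k} = 1"
  proof (rule X.ex_upper_density_1)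
    show "countable (range V \<union> range W)" by simp
    show "open (V' k)" if "V' \<in> range V \<union> range W" "k \<ge> 1" for V' k
      using that openV openW by fastforce
    show "\<exists>x\<in>U. \<exists>L>i. (1 - e) * real L < real (card ({k. x \<in> V' k} \<inter> {1..L}))"
      if "V' \<in> range V \<union> range W" "e > 0" "open U" "U \<noteq> {}" for V' e i U
      using that(1)
    proof
      assume "V' \<in> range V"
      then show ?thesis using denseV[OF that(2-4)] by fastforce
    next
      assume "V' \<in> range W"
      then show ?thesis using denseW[OF that(2-4)] by fastforce
    qed
  qed blast
  then have dV: "upper_density {k. x \<in> V n k} = 1" and dW: "upper_density {k. x \<in> W n k} = 1" for n
    by blast+
  have one: "1 \<in> {1..N}" using assms(6) by simp
  \<comment> \<open>Some \<open>k \<ge> 1\<close> has \<open>x \<in> W 0 k\<close>, and \<open>T 1 k\<close> vanishes at zero.\<close>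
  have "x \<noteq> 0"
  proof
    assume "x = 0"
    have "0 \<notin> W 0 k" if "k \<ge> 1" for k
      using seminorm_0[OF X.vector_space_axioms sn[OF one that, of m]] one unfolding W_def by force
    then have "{k. x \<in> W 0 k} \<inter> {1..L} = {}" for L using \<open>x = 0\<close> by auto
    with dW[of 0] show False
      unfolding upper_density_eq_1_iff by (auto dest!: spec[of _ "1::real"])
  qed
  moreover have "\<exists>A. upper_density A = 1 \<and> (\<forall>j\<in>{1..N}. ((\<lambda>k. T j k x) \<longlongrightarrow> 0) (seq_within A))"
  proof -
    have "x \<in> V n k" if "x \<in> V (Suc n) k" for n k
      unfolding V_def mem_Collect_eq
    proof
      fix j assume "j \<in> {1..N}"
      with that have "seminorm_of G (Suc n) (T j k x) < 1 / real (Suc (Suc n))" by (simp add: V_def)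
      also have "\<dots> \<le> 1 / real (Suc n)" by (simp add: field_simps)
      finally show "seminorm_of G n (T j k x) < 1 / real (Suc n)"
        using Y.p_Suc[of n "T j k x"] by linarith
    qed
    then have "decseq (\<lambda>n. {k. x \<in> V n k})" by (intro decseq_SucI) blast
    then obtain A where A: "upper_density A = 1" "\<And>n. \<forall>\<^sub>F k in seq_within A. k \<in> {k. x \<in> V n k}"
      by (rule upper_density_pseudo_intersection[OF _ dV]) blast
    have "((\<lambda>k. T j k x) \<longlongrightarrow> 0) (seq_within A)" if j: "j \<in> {1..N}" for j
      unfolding Y.tendsto_p_iff
    proof (intro allI impI)
      fix s and c :: real assume c: "c > 0"
      define n where "n = max s (nat \<lceil>1 / c\<rceil>)"
      have "1 / c \<le> real (Suc n)" unfolding n_def by linarith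
      then have n: "1 / real (Suc n) \<le> c" using c by (simp add: field_simps)
      show "\<forall>\<^sub>F k in seq_within A. seminorm_of G s (T j k x - 0) < c"
        using A(2)[of n]
      proof eventually_elim
        case (elim k)
        then have "seminorm_of G n (T j k x) < 1 / real (Suc n)" using j by (simp add: V_def)
        with n Y.p_mono[of s n "T j k x"] show ?case by (simp add: n_def del: of_nat_Suc)
      qed
    qed
    with A(1) show ?thesis by blast
  qed
  moreover have "\<exists>B. upper_density B = 1 \<and>
    (\<forall>j\<in>{1..N}. filterlim (\<lambda>k. seminorm_of G m (T j k x)) at_top (seq_within B))"
  proof -
    have "decseq (\<lambda>n. {k. x \<in> W n k})" by (intro decseq_SucI) (force simp: W_def)
    then obtain B where B: "upper_density B = 1" "\<And>n. \<forall>\<^sub>F k in seq_within B. k \<in> {k. x \<in> W n k}"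
      by (rule upper_density_pseudo_intersection[OF _ dW]) blast
    have "filterlim (\<lambda>k. seminorm_of G m (T j k x)) at_top (seq_within B)" if j: "j \<in> {1..N}" for j
      unfolding filterlim_at_top
    proof
      fix Z :: real
      show "\<forall>\<^sub>F k in seq_within B. Z \<le> seminorm_of G m (T j k x)"
        using B(2)[of "nat \<lceil>Z\<rceil>"]
      proof eventually_elim
        case (elim k)
        then have "real (nat \<lceil>Z\<rceil>) < seminorm_of G m (T j k x)" using j by (simp add: W_def)
        then show ?case by linarith
      qed
    qed
    with B(1) show ?thesis by blast
  qed
  ultimately have "distributionally_irregular G N T x"
    unfolding distributionally_irregular_def by blast
  moreover from this have "distributionally_chaotic G N T"
    by (intro irregular_imp_chaotic[where T = T, OF assms(5) _ X.vector_space_axioms Yf.vector_space_axioms] lin)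
  ultimately show ?thesis by blast
qed

end
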